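(* Let $M$ be a $C^1$ Finsler manifold modeled on a Banach space $X$ that admits a $C^1$ Lipschitz bump function. If $f\colon M\to(-\infty,+\infty]$ is proper and lower semicontinuous, then the set of points $x\in\operatorname{dom}(f)$ at which $f$ is subdifferentiable (i.e. $D^-f(x)\neq\emptyset$) is dense in $\operatorname{dom}(f)$.
   Context: $C^1$ Finsler manifold (in the sense of Palais): a connected, paracompact $C^1$ Banach manifold $M$ modeled on a Banach space $(X,\|\cdot\|)$, with a continuous map $\|\cdot\|_M:TM\to[0,\infty)$ such that: (P1) for every $x\in M$ the restriction $\|\cdot\|_x$ of $\|\cdot\|_M$ to $T_xM$ is a norm such that for every chart $\varphi:U\to X$ with $x\in U$, the norm $v\in X\mapsto\|d\varphi^{-1}(\varphi(x))(v)\|_x$ is equivalent to $\|\cdot\|$; (P2) for every $x_0\in M$, $\varepsilon>0$ and chart $\varphi:U\to X$ with $x_0\in U$ there is an open neighborhood $W$ of $x_0$ such that for all $x\in W$, $v\in X$, $\frac{1}{1+\varepsilon}\|d\varphi^{-1}(\varphi(x_0))(v)\|_{x_0}\le\|d\varphi^{-1}(\varphi(x))(v)\|_x\le(1+\varepsilon)\|d\varphi^{-1}(\varphi(x_0))(v)\|_{x_0}$. $C^1$ Lipschitz bump function on $X$: a $C^1$, Lipschitz function $b:X\to\mathbb{R}$ with bounded, non-empty support. $\operatorname{dom}(f)=\{x\in M: f(x)<+\infty\}$; $f$ is proper if $\operatorname{dom}(f)\ne\emptyset$. Subdifferential: for $x\in\operatorname{dom}(f)$, $D^-f(x)=\{dg(x):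 g:M\to\mathbb{R}\text{ is }C^1\text{ and }f-g\text{ attains a local minimum at }x\}\subset T_xM^*$. *)

theory Defs
  imports "HOL-Analysis.Analysis"
begin

section \<open>Maps of class $C^1$ between normed spaces\<close>

text \<open>Intended for open \<open>S\<close>.  The derivative is continuous for the operator norm.\<close>

definition C1_on :: "'a::real_normed_vector set \<Rightarrow> ('a \<Rightarrow> 'b::real_normed_vector) \<Rightarrow> bool" where
  "C1_on S f \<longleftrightarrow>
     (\<exists>f' :: 'a \<Rightarrow> 'a \<Rightarrow>\<^sub>L 'b.
        (\<forall>x\<in>S. (f has_derivative blinfun_apply (f' x)) (at x)) \<and> continuous_on S f')"

definition C1_Lipschitz_bump :: "('x::real_normed_vector \<Rightarrow> real) \<Rightarrow> bool" where
  "C1_Lipschitz_bump b \<longleftrightarrow>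
     C1_on UNIV b \<and> (\<exists>L. L-lipschitz_on UNIV b) \<and>
     bounded (closure {x. b x \<noteq> 0}) \<and> closure {x. b x \<noteq> 0} \<noteq> {}"

section \<open>$C^1$ Banach manifolds\<close>

definition paracompact_space :: "'a topology \<Rightarrow> bool" where
  "paracompact_space T \<longleftrightarrow>
     (\<forall>\<U>. (\<forall>U\<in>\<U>. openin T U) \<and> \<Union>\<U> = topspace T \<longrightarrow>
        (\<exists>\<V>. (\<forall>V\<in>\<V>. openin T V \<and> (\<exists>U\<in>\<U>. V \<subseteq> U)) \<and> \<Union>\<V> = topspace T \<and>
             locally_finite_in T \<V>))"

text \<open>
  A chart \<open>(U, \<phi>)\<close> carries its domain; values of \<open>\<phi>\<close> outside \<open>U\<close> are irrelevant, and
  \<open>chart_inv (U, \<phi>)\<close> is the inverse of \<open>\<phi>\<close>, meaningful on \<open>\<phi> ` U\<close> only.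
\<close>

type_synonym ('m, 'x) chart = "'m set \<times> ('m \<Rightarrow> 'x)"

definition chart_inv :: "('m, 'x) chart \<Rightarrow> 'x \<Rightarrow> 'm" where
  "chart_inv c = inv_into (fst c) (snd c)"

definition is_chart :: "('m::topological_space, 'x::real_normed_vector) chart \<Rightarrow> bool" where
  "is_chart c \<longleftrightarrow>
     open (fst c) \<and> open (snd c ` fst c) \<and>
     homeomorphism (fst c) (snd c ` fst c) (snd c) (chart_inv c)"

definition transition :: "('m, 'x) chart \<Rightarrow> ('m, 'x) chart \<Rightarrow> 'x \<Rightarrow> 'x" where
  "transition c d = snd d \<circ> chart_inv c"

definition C1_compatible ::
    "('m, 'x::real_normed_vector) chart \<Rightarrow> ('m, 'x) chart \<Rightarrow> bool" where
  "C1_compatible c d \<longleftrightarrow>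
     C1_on (snd c ` (fst c \<inter> fst d)) (transition c d) \<and>
     C1_on (snd d ` (fst c \<inter> fst d)) (transition d c)"

text \<open>
  A $C^1$ structure on the whole type \<open>'m\<close> is a maximal $C^1$ atlas, so that ``a chart of the
  manifold'' is just an element of it.
\<close>

definition C1_structure ::
    "('m::topological_space, 'x::real_normed_vector) chart set \<Rightarrow> bool" where
  "C1_structure \<A> \<longleftrightarrow>
     (\<forall>c\<in>\<A>. is_chart c) \<and> (\<Union>c\<in>\<A>. fst c) = UNIV \<and>
     (\<forall>c\<in>\<A>. \<forall>d\<in>\<A>. C1_compatible c d) \<and>
     (\<forall>c. is_chart c \<and> (\<forall>d\<in>\<A>. C1_compatible c d) \<longrightarrow> c \<in> \<A>)"

definition charts_at :: "('m, 'x) chart set \<Rightarrow> 'm \<Rightarrow> ('m, 'x) chart set" where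
  "charts_at \<A> x = {c \<in> \<A>. x \<in> fst c}"

definition C1_fun ::
    "('m, 'x::real_normed_vector) chart set \<Rightarrow> ('m \<Rightarrow> real) \<Rightarrow> bool" where
  "C1_fun \<A> g \<longleftrightarrow> (\<forall>c\<in>\<A>. C1_on (snd c ` fst c) (g \<circ> chart_inv c))"

section \<open>Tangent bundle\<close>

text \<open>
  A tangent vector at \<open>x\<close> is an equivalence class of pairs \<open>(c, v)\<close>, where \<open>c\<close> is a chart at
  \<open>x\<close> and \<open>v\<close> a vector of the model space, and \<open>(c, v)\<close> is identified with \<open>(d, w)\<close> if \<open>w\<close> is
  the image of \<open>v\<close> under the derivative of the transition map.  Such a class contains exactly
  one pair for each chart at \<open>x\<close>; it is encoded as the function sending a chart \<open>c\<close> at \<open>x\<close> to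
  the corresponding \<open>v\<close> (and everything else to 0).  The vector space operations are then
  pointwise.
\<close>

type_synonym ('m, 'x) tangent = "('m, 'x) chart \<Rightarrow> 'x"

definition transition_deriv ::
    "('m, 'x::real_normed_vector) chart \<Rightarrow> ('m, 'x) chart \<Rightarrow> 'm \<Rightarrow> 'x \<Rightarrow> 'x" where
  "transition_deriv c d x = frechet_derivative (transition c d) (at (snd c x))"

definition tangent_space ::
    "('m, 'x::real_normed_vector) chart set \<Rightarrow> 'm \<Rightarrow> ('m, 'x) tangent set" where
  "tangent_space \<A> x =
     {\<xi>. (\<forall>c\<in>charts_at \<A> x. \<forall>d\<in>charts_at \<A> x. \<xi> d = transition_deriv c d x (\<xi> c)) \<and>
         (\<forall>c. c \<notin> charts_at \<A> x \<longrightarrow> \<xi> c = 0)}"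

text \<open>\<open>d_chart_inv \<A> c x v\<close> is $d\varphi^{-1}(\varphi(x))(v)$ for \<open>c = (U, \<phi>)\<close> and \<open>x \<in> U\<close>, i.e.
  the tangent vector at \<open>x\<close> whose representative in \<open>c\<close> is \<open>v\<close>.\<close>

definition d_chart_inv ::
    "('m, 'x::real_normed_vector) chart set \<Rightarrow> ('m, 'x) chart \<Rightarrow> 'm \<Rightarrow> 'x \<Rightarrow> ('m, 'x) tangent" where
  "d_chart_inv \<A> c x v = (\<lambda>d. if d \<in> charts_at \<A> x then transition_deriv c d x v else 0)"

text \<open>The topology of $TM$: generated by the preimages of open sets under the bundle charts
  \<open>(x, \<xi>) \<mapsto> (\<phi> x, \<xi> c)\<close>, \<open>c = (U, \<phi>)\<close>; its carrier is the set of all pairs \<open>(x, \<xi>)\<close>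
  with \<open>\<xi>\<close> tangent at \<open>x\<close>.\<close>

definition tangent_bundle ::
    "('m, 'x::real_normed_vector) chart set \<Rightarrow> ('m \<times> ('m, 'x) tangent) topology" where
  "tangent_bundle \<A> = topology_generated_by
     {{(x, \<xi>). x \<in> fst c \<and> \<xi> \<in> tangent_space \<A> x \<and> (snd c x, \<xi> c) \<in> W} | c W.
        c \<in> \<A> \<and> open W}"

section \<open>Finsler structures in the sense of Palais\<close>

definition is_norm_on_tangent_space ::
    "('m, 'x::real_normed_vector) chart set \<Rightarrow> 'm \<Rightarrow> (('m, 'x) tangent \<Rightarrow> real) \<Rightarrow> bool" where
  "is_norm_on_tangent_space \<A> x n \<longleftrightarrow>
     (\<forall>\<xi>\<in>tangent_space \<A> x. 0 \<le> n \<xi> \<and> (n \<xi> = 0 \<longleftrightarrow> \<xi> = (\<lambda>c. 0))) \<and>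
     (\<forall>\<xi>\<in>tangent_space \<A> x. \<forall>a. n (\<lambda>c. a *\<^sub>R \<xi> c) = \<bar>a\<bar> * n \<xi>) \<and>
     (\<forall>\<xi>\<in>tangent_space \<A> x. \<forall>\<eta>\<in>tangent_space \<A> x. n (\<lambda>c. \<xi> c + \<eta> c) \<le> n \<xi> + n \<eta>)"

definition equivalent_to_norm :: "('x::real_normed_vector \<Rightarrow> real) \<Rightarrow> bool" where
  "equivalent_to_norm p \<longleftrightarrow> (\<exists>m>0. \<exists>K>0. \<forall>v. m * norm v \<le> p v \<and> p v \<le> K * norm v)"

definition finsler_P1 ::
    "('m, 'x::real_normed_vector) chart set \<Rightarrow> ('m \<times> ('m, 'x) tangent \<Rightarrow> real) \<Rightarrow> bool" where
  "finsler_P1 \<A> N \<longleftrightarrow>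
     (\<forall>x. is_norm_on_tangent_space \<A> x (\<lambda>\<xi>. N (x, \<xi>)) \<and>
          (\<forall>c\<in>charts_at \<A> x. equivalent_to_norm (\<lambda>v. N (x, d_chart_inv \<A> c x v))))"

definition finsler_P2 ::
    "('m::topological_space, 'x::real_normed_vector) chart set
      \<Rightarrow> ('m \<times> ('m, 'x) tangent \<Rightarrow> real) \<Rightarrow> bool" where
  "finsler_P2 \<A> N \<longleftrightarrow>
     (\<forall>x0. \<forall>\<epsilon>>0. \<forall>c\<in>charts_at \<A> x0.
        \<exists>W. open W \<and> x0 \<in> W \<and> W \<subseteq> fst c \<and>
          (\<forall>x\<in>W. \<forall>v.
             1 / (1 + \<epsilon>) * N (x0, d_chart_inv \<A> c x0 v) \<le> N (x, d_chart_inv \<A> c x v) \<and>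
             N (x, d_chart_inv \<A> c x v) \<le> (1 + \<epsilon>) * N (x0, d_chart_inv \<A> c x0 v)))"

definition C1_Finsler_manifold ::
    "('m::t2_space, 'x::banach) chart set \<Rightarrow> ('m \<times> ('m, 'x) tangent \<Rightarrow> real) \<Rightarrow> bool" where
  "C1_Finsler_manifold \<A> N \<longleftrightarrow>
     connected (UNIV :: 'm set) \<and> paracompact_space (euclidean :: 'm topology) \<and>
     C1_structure \<A> \<and>
     continuous_map (tangent_bundle \<A>) (top_of_set {0..}) N \<and>
     finsler_P1 \<A> N \<and> finsler_P2 \<A> N"

section \<open>Extended real functions and subdifferentials\<close>

definition edom :: "('m \<Rightarrow> ereal) \<Rightarrow> 'm set" where
  "edom f = {x. f x < \<infinity>}"

definition proper_fun :: "('m \<Rightarrow> ereal) \<Rightarrow> bool" where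
  "proper_fun f \<longleftrightarrow> edom f \<noteq> {}"

definition lower_semicontinuous :: "('m::topological_space \<Rightarrow> ereal) \<Rightarrow> bool" where
  "lower_semicontinuous f \<longleftrightarrow> (\<forall>x. \<forall>a<f x. \<forall>\<^sub>F y in nhds x. a < f y)"

text \<open>$dg(x)$ as a functional on the tangent space at \<open>x\<close> (extensional, i.e. \<open>undefined\<close> elsewhere).
  For $C^1$ functions \<open>g\<close> it does not depend on the chart chosen.\<close>

definition differential ::
    "('m, 'x::real_normed_vector) chart set \<Rightarrow> ('m \<Rightarrow> real) \<Rightarrow> 'm \<Rightarrow> ('m, 'x) tangent \<Rightarrow> real" where
  "differential \<A> g x =
     (let c = (SOME c. c \<in> charts_at \<A> x) in
      restrict (\<lambda>\<xi>. frechet_derivative (g \<circ> chart_inv c) (at (snd c x)) (\<xi> c))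
        (tangent_space \<A> x))"

definition local_minimum_at :: "('m::topological_space \<Rightarrow> ereal) \<Rightarrow> 'm \<Rightarrow> bool" where
  "local_minimum_at h x \<longleftrightarrow> (\<forall>\<^sub>F y in nhds x. h x \<le> h y)"

text \<open>Only meaningful for \<open>x \<in> edom f\<close>.\<close>

definition subdifferential ::
    "('m::topological_space, 'x::real_normed_vector) chart set
      \<Rightarrow> ('m \<Rightarrow> ereal) \<Rightarrow> 'm \<Rightarrow> (('m, 'x) tangent \<Rightarrow> real) set" where
  "subdifferential \<A> f x =
     {differential \<A> g x | g. C1_fun \<A> g \<and> local_minimum_at (\<lambda>y. f y - ereal (g y)) x}"

end

theory Submission
  imports Defs
begin

text \<open>
  In a chart the statement becomes a smooth variational principle in the spirit of Deville, Godefroy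
  and Zizler on a ball of the model space.  Rescaled bumps \<open>u\<^sub>n\<close>, of height proportional to
  $4^{-n}$ and supported in a ball of radius $R 2^{-n}$, are subtracted successively, the \<open>n\<close>-th one
  centred at a point that minimises the function perturbed so far up to half of \<open>u\<^sub>n 0\<close>.  Outside
  the small ball the perturbation did not change the function, so the next centre lies in that
  ball; the centres converge, and their limit minimises the function perturbed by the whole
  series, which is $C^1$ because the derivatives of the \<open>u\<^sub>n\<close> are $O(2^{-n})$.  If the first bump is
  high enough, any given point of the domain may serve as the first centre, so the minimiser is as
  close to it as desired.  The perturbation is supported in a small ball, and paracompactness
  (through regularity) makes the preimage of that ball closed in the manifold, so that the
  perturbation extends by zero to a $C^1$ function on the manifold.
\<close>

section \<open>Functions of class $C^1$\<close>

lemma C1_on_cong: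
  assumes "C1_on S f" "open S" "\<And>x. x \<in> S \<Longrightarrow> f x = g x"
  shows "C1_on S g"
proof -
  from assms(1) obtain f' where f': "\<And>x. x \<in> S \<Longrightarrow> (f has_derivative blinfun_apply (f' x)) (at x)"
    "continuous_on S f'" unfolding C1_on_def by blast
  have "(g has_derivative blinfun_apply (f' x)) (at x)" if "x \<in> S" for x
    by (rule has_derivative_transform_within_open[OF f'(1)[OF that] assms(2) that]) (rule assms(3))
  with f'(2) show ?thesis unfolding C1_on_def by blast
qed

lemma C1_on_subset: "C1_on S f \<Longrightarrow> T \<subseteq> S \<Longrightarrow> C1_on T f"
  unfolding C1_on_def by (meson continuous_on_subset subsetD)

lemma C1_on_const: "C1_on S (\<lambda>x. c)"
  unfolding C1_on_def by (rule exI[of _ "\<lambda>_. 0"]) (auto simp: zero_blinfun.rep_eq)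

text \<open>On the overlap, uniqueness of the derivative makes the two derivative maps coincide, so
  the pasted map is continuous on either open set. This later glues a function to zero.\<close>

lemma C1_on_open_Un:
  assumes "C1_on S f" "C1_on T f" "open S" "open T"
  shows "C1_on (S \<union> T) f"
proof -
  from assms(1) obtain s where s: "\<And>x. x \<in> S \<Longrightarrow> (f has_derivative blinfun_apply (s x)) (at x)"
    "continuous_on S s" unfolding C1_on_def by blast
  from assms(2) obtain t where t: "\<And>x. x \<in> T \<Longrightarrow> (f has_derivative blinfun_apply (t x)) (at x)"
    "continuous_on T t" unfolding C1_on_def by blast
  define d where "d x = (if x \<in> S then s x else t x)" for x
  have eq: "s x = t x" if "x \<in> S" "x \<in> T" for x
    using has_derivative_unique[OF s(1)[OF that(1)] t(1)[OF that(2)]]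
    by (simp add: blinfun_apply_inject)
  have "continuous_on S d"
    using s(2) by (rule continuous_on_eq) (simp add: d_def)
  moreover have "continuous_on T d"
    using t(2) by (rule continuous_on_eq) (simp add: d_def eq)
  ultimately have "continuous_on (S \<union> T) d"
    using assms(3,4) by (intro continuous_on_open_Un)
  moreover have "(f has_derivative blinfun_apply (d x)) (at x)" if "x \<in> S \<union> T" for x
    using that s(1) t(1) by (auto simp: d_def)
  ultimately show ?thesis unfolding C1_on_def by (intro exI[of _ d] conjI ballI)
qed

lemma C1_on_compose:
  assumes "C1_on S f" "C1_on T g" "f ` S \<subseteq> T"
  shows "C1_on S (g \<circ> f)"
proof -
  from assms(1) obtain f' where f': "\<And>x. x \<in> S \<Longrightarrow> (f has_derivative blinfun_apply (f' x)) (at x)"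
    "continuous_on S f'" unfolding C1_on_def by blast
  from assms(2) obtain g' where g': "\<And>x. x \<in> T \<Longrightarrow> (g has_derivative blinfun_apply (g' x)) (at x)"
    "continuous_on T g'" unfolding C1_on_def by blast
  have cf: "continuous_on S f"
    using f'(1) has_derivative_continuous
    by (metis continuous_at_imp_continuous_on)
  have "continuous_on S (\<lambda>x. g' (f x))"
    by (rule continuous_on_compose2[OF g'(2) cf assms(3)])
  then have "continuous_on S (\<lambda>x. g' (f x) o\<^sub>L f' x)"
    using f'(2) by (intro continuous_intros)
  moreover have "(g \<circ> f has_derivative blinfun_apply (g' (f x) o\<^sub>L f' x)) (at x)" if "x \<in> S" for x
  proof -
    have "f x \<in> T" using that assms(3) by blast
    from diff_chain_at[OF f'(1)[OF that] g'(1)[OF this]] show ?thesis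
      by (simp add: blinfun_compose.rep_eq o_def)
  qed
  ultimately show ?thesis
    unfolding C1_on_def by (intro exI[of _ "\<lambda>x. g' (f x) o\<^sub>L f' x"] conjI ballI)
qed

text \<open>The bound \<open>A n\<close> makes the derivatives sum uniformly in operator norm
  (Weierstrass M-test). This gives both continuity of the limit \<open>w\<close> and the error
  estimate \<open>e * norm h\<close> behind termwise differentiation.\<close>

lemma C1_on_suminf:
  fixes v :: "nat \<Rightarrow> 'a::real_normed_vector \<Rightarrow> 'b::banach"
  assumes der: "\<And>n x. (v n has_derivative blinfun_apply (v' n x)) (at x)"
    and cont: "\<And>n. continuous_on UNIV (v' n)"
    and bd': "\<And>n x. norm (v' n x) \<le> A n" "summable A"
    and sm: "\<And>x. summable (\<lambda>n. v n x)"
  shows "C1_on UNIV (\<lambda>x. \<Sum>n. v n x)"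
proof -
  define w where "w x = (\<Sum>n. v' n x)" for x
  have ul: "uniform_limit UNIV (\<lambda>n x. \<Sum>i<n. v' i x) w sequentially"
    unfolding w_def by (rule Weierstrass_m_test[OF bd'(1) bd'(2)])
  have cw: "continuous_on UNIV w"
    by (rule uniform_limit_theorem[OF _ ul])
       (auto intro!: always_eventually continuous_on_sum cont)
  have "\<exists>g. \<forall>x\<in>UNIV. (\<lambda>n. v n x) sums (g x) \<and> (g has_derivative blinfun_apply (w x)) (at x within UNIV)"
  proof (rule has_derivative_series)
    show "\<forall>\<^sub>F n in sequentially. \<forall>x\<in>UNIV. \<forall>h. norm ((\<Sum>i<n. blinfun_apply (v' i x) h) - blinfun_apply (w x) h) \<le> e * norm h"
      if "e > 0" for e
      using uniform_limitD[OF ul that]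
    proof eventually_elim
      case (elim n)
      show ?case
      proof (intro ballI allI)
        fix x h
        have "norm ((\<Sum>i<n. blinfun_apply (v' i x) h) - blinfun_apply (w x) h)
            = norm (blinfun_apply ((\<Sum>i<n. v' i x) - w x) h)"
          by (simp add: blinfun.sum_left blinfun.diff_left)
        also have "\<dots> \<le> norm ((\<Sum>i<n. v' i x) - w x) * norm h" by (rule norm_blinfun)
        also have "\<dots> \<le> e * norm h"
          using elim by (intro mult_right_mono) (auto simp: dist_norm less_imp_le)
        finally show "norm ((\<Sum>i<n. blinfun_apply (v' i x) h) - blinfun_apply (w x) h) \<le> e * norm h" .
      qed
    qed
    show "(\<lambda>n. v n 0) sums (\<Sum>n. v n 0)" using sm by (rule summable_sums)
  qed (use der in auto)
  then obtain g where g: "\<And>x. (\<lambda>n. v n x) sums (g x)"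
    "\<And>x. (g has_derivative blinfun_apply (w x)) (at x)" by auto
  have "g = (\<lambda>x. \<Sum>n. v n x)" using sums_unique[OF g(1)] by auto
  then show ?thesis unfolding C1_on_def using g(2) cw by auto
qed

section \<open>Normalised bumps with bounded derivative\<close>

text \<open>Difference quotients in direction \<open>v\<close> are bounded by
  \<open>L * norm v\<close> and converge to \<open>blinfun_apply D v\<close>. Thus the Lipschitz
  hypothesis on the bump becomes the uniform derivative bound that the series needs.\<close>

lemma lipschitz_on_imp_norm_derivative_le:
  fixes f :: "'a::real_normed_vector \<Rightarrow> 'b::real_normed_vector"
  assumes lip: "L-lipschitz_on UNIV f"
    and der: "(f has_derivative blinfun_apply D) (at x)"
  shows "norm D \<le> L"
proof (rule norm_blinfun_bound)
  show "0 \<le> L" using lip by (rule lipschitz_on_nonneg)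
  fix v
  have "((\<lambda>t. f (x + t *\<^sub>R v)) has_derivative (\<lambda>t. blinfun_apply D (t *\<^sub>R v))) (at 0)"
    by (rule has_derivative_compose[where f="\<lambda>t. x + t *\<^sub>R v" and g=f and s=UNIV, simplified])
       (auto intro!: derivative_eq_intros der)
  then have "((\<lambda>t. f (x + t *\<^sub>R v)) has_vector_derivative blinfun_apply D v) (at 0)"
    by (simp add: has_vector_derivative_def blinfun.scaleR_right)
  then have "((\<lambda>t. norm (f (x + t *\<^sub>R v) - f x - t *\<^sub>R blinfun_apply D v) / \<bar>t\<bar>) \<longlongrightarrow> 0) (at 0)"
    by (simp add: has_vector_derivative_def has_derivative_iff_norm)
  moreover have "\<forall>\<^sub>F t in at 0. norm (f (x + t *\<^sub>R v) - f x - t *\<^sub>R blinfun_apply D v) / \<bar>t\<bar>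
      = norm ((f (x + t *\<^sub>R v) - f x) /\<^sub>R t - blinfun_apply D v)"
    unfolding eventually_at_filter
  proof (intro always_eventually allI impI)
    fix t :: real assume "t \<noteq> 0"
    then have eq: "(f (x + t *\<^sub>R v) - f x) /\<^sub>R t - blinfun_apply D v
        = (f (x + t *\<^sub>R v) - f x - t *\<^sub>R blinfun_apply D v) /\<^sub>R t"
      by (simp add: scaleR_right_diff_distrib)
    show "norm (f (x + t *\<^sub>R v) - f x - t *\<^sub>R blinfun_apply D v) / \<bar>t\<bar>
        = norm ((f (x + t *\<^sub>R v) - f x) /\<^sub>R t - blinfun_apply D v)"
      unfolding eq norm_scaleR by (simp add: divide_inverse)
  qed
  ultimately have "((\<lambda>t. norm ((f (x + t *\<^sub>R v) - f x) /\<^sub>R t - blinfun_apply D v)) \<longlongrightarrow> 0) (at 0)"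
    by (rule Lim_transform_eventually)
  then have "((\<lambda>t. (f (x + t *\<^sub>R v) - f x) /\<^sub>R t) \<longlongrightarrow> blinfun_apply D v) (at 0)"
    by (rule LIM_zero_cancel[OF tendsto_norm_zero_cancel])
  then show "norm (blinfun_apply D v) \<le> L * norm v"
  proof (rule Lim_norm_ubound[rotated])
    show "\<forall>\<^sub>F t in at 0. norm ((f (x + t *\<^sub>R v) - f x) /\<^sub>R t) \<le> L * norm v"
      unfolding eventually_at_filter
    proof (intro always_eventually allI impI)
      fix t :: real assume "t \<noteq> 0"
      have "norm (f (x + t *\<^sub>R v) - f x) \<le> L * (\<bar>t\<bar> * norm v)"
        using lipschitz_on_normD[OF lip, of "x + t *\<^sub>R v" x] by simp
      then show "norm ((f (x + t *\<^sub>R v) - f x) /\<^sub>R t) \<le> L * norm v"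
        using \<open>t \<noteq> 0\<close> unfolding norm_scaleR by (simp add: field_simps)
    qed
  qed simp
qed

text \<open>The bump is translated to a point \<open>p\<close> where it does not vanish, dilated,
  and divided by \<open>b p\<close>.\<close>

lemma C1_Lipschitz_bump_centred:
  fixes b :: "'x::real_normed_vector \<Rightarrow> real"
  assumes "C1_Lipschitz_bump b" "\<rho> > 0"
  obtains u :: "'x \<Rightarrow> real" and u' L B where "\<And>x. (u has_derivative blinfun_apply (u' x)) (at x)"
    "continuous_on UNIV u'" "\<And>x. norm (u' x) \<le> L" "\<And>x. \<bar>u x\<bar> \<le> B" "u 0 = (1::real)"
    "\<And>x. norm x \<ge> \<rho> \<Longrightarrow> u x = 0"
proof -
  from assms(1) obtain b' L where
    b': "\<And>x. (b has_derivative blinfun_apply (b' x)) (at x)" "continuous_on UNIV b'"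
    and L: "L-lipschitz_on UNIV b" and bd: "bounded (closure {x. b x \<noteq> 0})"
    and ne: "closure {x. b x \<noteq> 0} \<noteq> {}"
    unfolding C1_Lipschitz_bump_def C1_on_def by auto
  from ne obtain p where p: "b p \<noteq> 0" by auto
  have "bounded {x. b x \<noteq> 0}" using bd bounded_subset closure_subset by blast
  then obtain e where e: "\<And>x. b x \<noteq> 0 \<Longrightarrow> dist p x \<le> e"
    unfolding bounded_any_center[where a=p] by blast
  define R where "R = \<bar>e\<bar> + 1"
  have R: "R > 0" "b x \<noteq> 0 \<Longrightarrow> dist p x \<le> R" for x
    using e[of x] by (auto simp: R_def)
  \<comment> \<open>A vector of norm at least \<open>\<rho>\<close> is sent to distance at least
    \<open>2 * R\<close> from \<open>p\<close>, where \<open>b\<close> vanishes.\<close>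
  define s where "s = 2 * R / \<rho>"
  have s: "s > 0" using R(1) assms(2) by (simp add: s_def)
  define u where "u x = b (p + s *\<^sub>R x) / b p" for x
  define u' where "u' x = (s / b p) *\<^sub>R b' (p + s *\<^sub>R x)" for x
  have "(u has_derivative blinfun_apply (u' x)) (at x)" for x
  proof -
    have "((\<lambda>x. b (p + s *\<^sub>R x)) has_derivative (\<lambda>h. blinfun_apply (b' (p + s *\<^sub>R x)) (s *\<^sub>R h))) (at x)"
      by (rule has_derivative_compose[where f="\<lambda>x. p + s *\<^sub>R x" and g=b and s=UNIV, simplified])
         (auto intro!: derivative_eq_intros b')
    from has_derivative_mult_right[OF this, of "1 / b p"]
    have "(u has_derivative (\<lambda>h. 1 / b p * blinfun_apply (b' (p + s *\<^sub>R x)) (s *\<^sub>R h))) (at x)"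
      by (simp add: u_def[abs_def])
    then show ?thesis
      by (rule has_derivative_eq_rhs)
         (simp add: u'_def fun_eq_iff blinfun.scaleR_left blinfun.scaleR_right)
  qed
  moreover have "continuous_on UNIV u'"
    unfolding u'_def by (intro continuous_intros continuous_on_compose2[OF b'(2)]) auto
  moreover have "norm (u' x) \<le> \<bar>s / b p\<bar> * L" for x
  proof -
    have "norm (u' x) = \<bar>s / b p\<bar> * norm (b' (p + s *\<^sub>R x))" by (simp add: u'_def)
    also have "\<dots> \<le> \<bar>s / b p\<bar> * L"
      using lipschitz_on_imp_norm_derivative_le[OF L b'(1)] by (rule mult_left_mono) simp
    finally show ?thesis .
  qed
  \<comment> \<open>Where \<open>b\<close> does not vanish, its argument lies within
    \<open>R\<close> of \<open>p\<close>, so its value differs from \<open>b p\<close> by at most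
    \<open>L * R\<close>.\<close>
  moreover have "\<bar>u x\<bar> \<le> (\<bar>b p\<bar> + L * R) / \<bar>b p\<bar>" for x
  proof (cases "b (p + s *\<^sub>R x) = 0")
    case False
    have "\<bar>b (p + s *\<^sub>R x) - b p\<bar> \<le> L * dist (p + s *\<^sub>R x) p"
      using lipschitz_onD[OF L, of "p + s *\<^sub>R x" p] by (simp add: dist_real_def)
    also have "\<dots> \<le> L * R" using R(2)[OF False] lipschitz_on_nonneg[OF L]
      by (intro mult_left_mono) (auto simp: dist_commute)
    finally have "\<bar>b (p + s *\<^sub>R x)\<bar> \<le> \<bar>b p\<bar> + L * R" by linarith
    then show ?thesis by (simp add: u_def divide_right_mono)
  qed (use lipschitz_on_nonneg[OF L] R(1) in \<open>auto simp: u_def\<close>)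
  moreover have "u 0 = 1" using p by (simp add: u_def)
  moreover have "u x = 0" if "norm x \<ge> \<rho>" for x
  proof -
    have "s * \<rho> \<le> s * norm x" using that s by simp
    then have "dist p (p + s *\<^sub>R x) > R"
      using s R(1) assms(2) by (simp add: s_def dist_norm)
    then have "b (p + s *\<^sub>R x) = 0" using R(2)[of "p + s *\<^sub>R x"] by linarith
    then show ?thesis by (simp add: u_def)
  qed
  ultimately show thesis
    by (rule that[of u u' "\<bar>s / b p\<bar> * L" "(\<bar>b p\<bar> + L * R) / \<bar>b p\<bar>"])
qed

section \<open>Smooth variational principle\<close>

text \<open>The real-valued \<open>h\<close> on \<open>D\<close> stands for an extended-valued
  function. Its lower semicontinuity is encoded by sublevel sets closed in the whole space, which
  also forces the limit of the centres into \<open>D\<close>.\<close>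

lemma perturbed_minimum_exists:
  fixes D :: "'x::banach set" and h :: "'x \<Rightarrow> real" and u :: "nat \<Rightarrow> 'x \<Rightarrow> real"
  assumes lsc: "\<And>a. closed {x \<in> D. h x \<le> a}"
    and bdd: "\<And>x. x \<in> D \<Longrightarrow> m \<le> h x"
    and z0: "z0 \<in> D" "\<And>x. x \<in> D \<Longrightarrow> h z0 \<le> h x + u 0 0 / 2"
    and cont: "\<And>n. continuous_on UNIV (u n)"
    and bd: "\<And>n x. \<bar>u n x\<bar> \<le> A n" "summable A"
    and dec: "\<And>n. u (Suc n) 0 < u n 0" "\<And>n. 0 < u n 0" "(\<lambda>n. u n 0) \<longlonglongrightarrow> 0"
    and supp: "\<And>n x. norm x \<ge> R / 2 ^ n \<Longrightarrow> u n x = 0"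
    and R: "R > 0"
  obtains xs z where "\<And>n. dist z0 (xs n) \<le> 2 * R" "z \<in> D" "dist z0 z \<le> 2 * R"
    "\<And>y. y \<in> D \<Longrightarrow> h z - (\<Sum>n. u n (z - xs n)) \<le> h y - (\<Sum>n. u n (y - xs n))"
proof -
  \<comment> \<open>A state pairs the current centre with the perturbation accumulated so far. The
    upper bound \<open>M\<close> keeps the next infimum finite, and the clause for
    \<open>n = 0\<close> fixes the start.\<close>
  define P where "P n p \<longleftrightarrow> fst p \<in> D \<and>
      (\<forall>y\<in>D. h (fst p) - snd p (fst p) \<le> h y - snd p y + u n 0 / 2) \<and>
      (\<exists>M. \<forall>y. snd p y \<le> M) \<and> (n = 0 \<longrightarrow> p = (z0, \<lambda>_. 0))"
    for n :: nat and p :: "'x \<times> ('x \<Rightarrow> real)"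
  define Q where "Q n p q \<longleftrightarrow> snd q = (\<lambda>y. snd p y + u n (y - fst p))"
    for n :: nat and p q :: "'x \<times> ('x \<Rightarrow> real)"
  have "\<exists>F. \<forall>n. P n (F n) \<and> Q n (F n) (F (Suc n))"
  proof (rule dependent_nat_choice)
    show "\<exists>p. P 0 p" using z0 by (intro exI[of _ "(z0, \<lambda>_. 0)"]) (auto simp: P_def)
    fix p n assume p: "P n p"
    define g where "g y = snd p y + u n (y - fst p)" for y
    from p obtain M where M: "\<And>y. snd p y \<le> M" unfolding P_def by blast
    have gM: "g y \<le> M + A n" for y
      using M[of y] bd(1)[of n "y - fst p"] by (simp add: g_def)
    have bb: "bdd_below ((\<lambda>y. h y - g y) ` D)"
      using bdd gM by (intro bdd_belowI2[of _ "m - (M + A n)"]) (auto intro: diff_mono)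
    have "Inf ((\<lambda>y. h y - g y) ` D) < Inf ((\<lambda>y. h y - g y) ` D) + u (Suc n) 0 / 2"
      using dec(2)[of "Suc n"] by simp
    then obtain x where x: "x \<in> D" "h x - g x < Inf ((\<lambda>y. h y - g y) ` D) + u (Suc n) 0 / 2"
      using z0(1) by (subst (asm) cInf_less_iff[OF _ bb]) auto
    have "h x - g x \<le> h y - g y + u (Suc n) 0 / 2" if "y \<in> D" for y
      using x(2) cInf_lower[OF imageI[OF that] bb] by simp
    then have "P (Suc n) (x, g) \<and> Q n p (x, g)"
      using x(1) gM by (auto simp: P_def Q_def g_def[abs_def])
    then show "\<exists>q. P (Suc n) q \<and> Q n p q" by blast
  qed
  then obtain F where PF: "\<And>n. P n (F n)" and QF: "\<And>n. Q n (F n) (F (Suc n))" by blast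
  define xs where "xs n = fst (F n)" for n
  have x0: "xs 0 = z0" and F0: "snd (F 0) = (\<lambda>_. 0)" using PF[of 0] by (auto simp: P_def xs_def)
  have FS: "snd (F (Suc n)) y = snd (F n) y + u n (y - xs n)" for n y
    using QF[of n] by (simp add: Q_def xs_def)
  have Fsum: "snd (F n) y = (\<Sum>i<n. u i (y - xs i))" for n y
    by (induction n) (simp_all add: F0 FS)
  have xD: "xs n \<in> D" for n using PF[of n] by (simp add: P_def xs_def)
  have near: "h (xs n) - snd (F n) (xs n) \<le> h y - snd (F n) y + u n 0 / 2" if "y \<in> D" for n y
    using PF[of n] that by (auto simp: P_def xs_def)
  \<comment> \<open>Otherwise the \<open>n\<close>-th bump vanishes at the next centre but has full
    height at the old one. Adding the two near-minimality inequalities then gives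
    \<open>u n 0 \<le> u (Suc n) 0\<close>, against the strict decrease.\<close>
  have step: "dist (xs n) (xs (Suc n)) \<le> R / 2 ^ n" for n
  proof (rule ccontr)
    assume "\<not> ?thesis"
    then have "u n (xs (Suc n) - xs n) = 0"
      by (intro supp) (simp add: dist_norm norm_minus_commute)
    then show False
      using near[OF xD, of n "Suc n"] near[OF xD, of "Suc n" n] dec(1)[of n]
      by (simp add: FS)
  qed
  \<comment> \<open>The bound is the partial sum of the step lengths \<open>R / 2 ^ i\<close> for
    \<open>i < n\<close>, which is what the induction carries.\<close>
  have dist0: "dist z0 (xs n) \<le> 2 * R - 2 * R / 2 ^ n" for n
  proof (induction n)
    case (Suc n)
    have "dist z0 (xs (Suc n)) \<le> dist z0 (xs n) + dist (xs n) (xs (Suc n))"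
      by (rule dist_triangle)
    also have "\<dots> \<le> 2 * R - 2 * R / 2 ^ n + R / 2 ^ n" using Suc step[of n] by simp
    finally show ?case by (simp add: field_simps)
  qed (simp add: x0)
  have dist0': "dist z0 (xs n) \<le> 2 * R" for n
    using dist0[of n] R by (smt (verit) divide_pos_pos zero_less_power)
  have "summable (\<lambda>n. xs (Suc n) - xs n)"
  proof (rule summable_comparison_test')
    show "summable (\<lambda>n. R * (1/2) ^ n)" by (intro summable_mult summable_geometric) simp
    show "norm (xs (Suc n) - xs n) \<le> R * (1/2) ^ n" for n
      using step[of n] by (simp add: dist_norm norm_minus_commute power_divide)
  qed
  then have "convergent (\<lambda>n. xs n - xs 0)"
    unfolding summable_iff_convergent sum_lessThan_telescope .
  then obtain l where "(\<lambda>n. xs n - xs 0) \<longlonglongrightarrow> l" unfolding convergent_def by blast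
  from tendsto_add[OF this tendsto_const[of "xs 0"]]
  obtain z where z: "xs \<longlonglongrightarrow> z" by auto
  have zdist: "dist z0 z \<le> 2 * R"
    by (rule tendsto_upperbound[OF tendsto_dist[OF tendsto_const z]]) (auto simp: dist0')
  define G where "G y = (\<Sum>n. u n (y - xs n))" for y
  have ul: "uniform_limit UNIV (\<lambda>n y. \<Sum>i<n. u i (y - xs i)) G sequentially"
    unfolding G_def by (rule Weierstrass_m_test[OF _ bd(2)]) (simp add: bd(1))
  have "continuous_on UNIV G"
    by (rule uniform_limit_theorem[OF _ ul])
       (auto intro!: always_eventually continuous_on_sum continuous_on_compose2[OF cont] continuous_intros)
  then have Gz: "(\<lambda>n. G (xs n)) \<longlonglongrightarrow> G z"
    using z by (auto simp: continuous_on_eq_continuous_at intro: isCont_tendsto_compose)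
  have Glim: "(\<lambda>n. snd (F n) y) \<longlonglongrightarrow> G y" for y
    unfolding Fsum by (rule tendsto_uniform_limitI[OF ul]) simp
  \<comment> \<open>The evaluation point moves with \<open>n\<close>, so pointwise convergence does
    not suffice; uniform convergence does.\<close>
  have Gdiff: "(\<lambda>n. snd (F n) (xs n) - G (xs n)) \<longlonglongrightarrow> 0"
  proof (rule tendstoI)
    fix e :: real assume "e > 0"
    from uniform_limitD[OF ul this]
    show "\<forall>\<^sub>F n in sequentially. dist (snd (F n) (xs n) - G (xs n)) 0 < e"
      by eventually_elim (simp add: Fsum dist_real_def)
  qed
  \<comment> \<open>Near-minimality bounds \<open>h (xs n)\<close> by \<open>?r n\<close>, in which
    \<open>G (xs n)\<close> is subtracted and added back. The slack \<open>e\<close> puts the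
    centres eventually into one closed sublevel set, which then contains their limit
    \<open>z\<close>.\<close>
  have key: "z \<in> D \<and> h z \<le> h y - G y + G z + e" if y: "y \<in> D" and e: "e > 0" for y e
  proof -
    let ?r = "\<lambda>n. h y - snd (F n) y + u n 0 / 2 + (snd (F n) (xs n) - G (xs n)) + G (xs n)"
    have "?r \<longlonglongrightarrow> h y - G y + 0 / 2 + 0 + G z"
      by (intro tendsto_intros Glim dec(3) Gdiff Gz) auto
    then have "\<forall>\<^sub>F n in sequentially. ?r n < h y - G y + G z + e"
      using e by (intro order_tendstoD(2)) auto
    then have "\<forall>\<^sub>F n in sequentially. xs n \<in> {x \<in> D. h x \<le> h y - G y + G z + e}"
    proof eventually_elim
      case (elim n)
      then show ?case using near[OF y, of n] xD[of n] by simp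
    qed
    then have "z \<in> {x \<in> D. h x \<le> h y - G y + G z + e}"
      by (rule Lim_in_closed_set[OF lsc _ sequentially_bot z])
    then show ?thesis by simp
  qed
  have "h z - G z \<le> h y - G y" if "y \<in> D" for y
    using field_le_epsilon[of "h z" "h y - G y + G z"] key[OF that] by simp
  moreover have "z \<in> D" using key[OF z0(1), of 1] by simp
  ultimately show thesis
    by (intro that[OF dist0' _ zdist]) (auto simp: G_def)
qed

text \<open>The iteration is fed with rescaled copies of one normalised bump. Vanishing of
  \<open>G\<close> beyond \<open>r\<close> permits the later extension by zero; the strict bound on
  \<open>dist z0 z\<close> keeps the minimiser interior to the ball.\<close>

lemma smooth_perturbed_minimum:
  fixes D :: "'x::banach set" and h :: "'x \<Rightarrow> real" and b :: "'x \<Rightarrow> real"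
  assumes "C1_Lipschitz_bump b"
    and lsc: "\<And>a. closed {x \<in> D. h x \<le> a}"
    and bdd: "\<And>x. x \<in> D \<Longrightarrow> m \<le> h x"
    and z0: "z0 \<in> D" and r: "r > 0"
  obtains G z where "C1_on UNIV G" "\<And>x. dist z0 x \<ge> r \<Longrightarrow> G x = (0::real)"
    "z \<in> D" "dist z0 z < r" "\<And>y. y \<in> D \<Longrightarrow> h z - G z \<le> h y - G y"
proof -
  \<comment> \<open>The centres stay within \<open>2 * R = r / 2\<close> of \<open>z0\<close> and
    each bump has radius at most \<open>r / 4\<close>, so all supports lie within
    \<open>3 * r / 4\<close>.\<close>
  define R where "R = r / 4"
  have R: "R > 0" using r by (simp add: R_def)
  obtain w :: "'x \<Rightarrow> real" and w' L B where w: "\<And>x. (w has_derivative blinfun_apply (w' x)) (at x)"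
    "continuous_on UNIV w'" "\<And>x. norm (w' x) \<le> L" "\<And>x. \<bar>w x\<bar> \<le> B" "w 0 = (1::real)"
    "\<And>x. norm x \<ge> R \<Longrightarrow> w x = 0"
    by (rule C1_Lipschitz_bump_centred[OF assms(1) R]) (rule that)
  \<comment> \<open>Half the height of the first bump exceeds \<open>h z0 - m\<close>, so
    \<open>z0\<close> is a minimum up to \<open>u 0 0 / 2\<close>.\<close>
  define \<epsilon> where "\<epsilon> = 2 * (h z0 - m) + 1"
  have \<epsilon>: "\<epsilon> > 0" using bdd[OF z0] by (simp add: \<epsilon>_def)
  \<comment> \<open>Dilation by \<open>2 ^ n\<close> shrinks the support but multiplies the
    derivative by \<open>2 ^ n\<close>; the height factor \<open>4 ^ n\<close> in the denominator
    leaves a summable bound of order \<open>1 / 2 ^ n\<close>.\<close>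
  define u where "u n x = \<epsilon> / 4 ^ n * w (2 ^ n *\<^sub>R x)" for n x
  define u' where "u' n x = (\<epsilon> / 2 ^ n) *\<^sub>R w' (2 ^ n *\<^sub>R x)" for n x
  have u0: "u n 0 = \<epsilon> * (1/4) ^ n" for n by (simp add: u_def w(5) power_divide)
  have der: "((\<lambda>x. u n (x - a)) has_derivative blinfun_apply (u' n (x - a))) (at x)" for n x a
  proof -
    have "((\<lambda>x. w (2 ^ n *\<^sub>R (x - a))) has_derivative
        (\<lambda>k. blinfun_apply (w' (2 ^ n *\<^sub>R (x - a))) (2 ^ n *\<^sub>R k))) (at x)"
      by (rule has_derivative_compose[where f="\<lambda>x. 2 ^ n *\<^sub>R (x - a)" and g=w and s=UNIV, simplified])
         (auto intro!: derivative_eq_intros w)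
    from has_derivative_mult_right[OF this, of "\<epsilon> / 4 ^ n"]
    have "((\<lambda>x. u n (x - a)) has_derivative
        (\<lambda>k. \<epsilon> / 4 ^ n * blinfun_apply (w' (2 ^ n *\<^sub>R (x - a))) (2 ^ n *\<^sub>R k))) (at x)"
      by (simp add: u_def)
    moreover have "(4::real) ^ n = 2 ^ n * 2 ^ n" by (simp flip: power_mult_distrib)
    ultimately show ?thesis
      by (elim has_derivative_eq_rhs)
         (simp add: u'_def fun_eq_iff blinfun.scaleR_left blinfun.scaleR_right)
  qed
  have cont: "continuous_on UNIV (u n)" for n
    using has_derivative_continuous[OF der[of n 0]]
    by (simp add: continuous_on_eq_continuous_at)
  have cont': "continuous_on UNIV (\<lambda>x. u' n (x - a))" for n a
    unfolding u'_def by (intro continuous_intros continuous_on_compose2[OF w(2)]) auto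
  have bd: "\<bar>u n x\<bar> \<le> \<epsilon> * B * (1/4) ^ n" for n x
  proof -
    have "\<bar>u n x\<bar> = \<epsilon> * (1/4) ^ n * \<bar>w (2 ^ n *\<^sub>R x)\<bar>"
      using \<epsilon> by (simp add: u_def abs_mult power_divide)
    also have "\<dots> \<le> \<epsilon> * (1/4) ^ n * B" using \<epsilon> w(4) by (intro mult_left_mono) auto
    finally show ?thesis by (simp add: mult_ac)
  qed
  have bd': "norm (u' n x) \<le> \<epsilon> * L * (1/2) ^ n" for n x
  proof -
    have "norm (u' n x) = \<epsilon> * (1/2) ^ n * norm (w' (2 ^ n *\<^sub>R x))"
      using \<epsilon> by (simp add: u'_def abs_mult power_divide)
    also have "\<dots> \<le> \<epsilon> * (1/2) ^ n * L" using \<epsilon> w(3) by (intro mult_left_mono) auto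
    finally show ?thesis by (simp add: mult_ac)
  qed
  have sA: "summable (\<lambda>n. c * (1/4) ^ n)" "summable (\<lambda>n. c * (1/2) ^ n)" for c :: real
    by (intro summable_mult summable_geometric; simp)+
  have supp: "u n x = 0" if "norm x \<ge> R / 2 ^ n" for n x
    unfolding u_def using that by (subst w(6)) (auto simp: field_simps)
  have first: "h z0 \<le> h x + u 0 0 / 2" if "x \<in> D" for x
    using bdd[OF that] by (simp add: u0 \<epsilon>_def field_simps)
  have dec: "u (Suc n) 0 < u n 0" "0 < u n 0" for n using \<epsilon> by (simp_all add: u0)
  have lim: "(\<lambda>n. u n 0) \<longlonglongrightarrow> 0"
    unfolding u0 by (intro tendsto_mult_right_zero LIMSEQ_power_zero) simp
  obtain xs z where xs: "\<And>n. dist z0 (xs n) \<le> 2 * R" "z \<in> D" "dist z0 z \<le> 2 * R"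
    "\<And>y. y \<in> D \<Longrightarrow> h z - (\<Sum>n. u n (z - xs n)) \<le> h y - (\<Sum>n. u n (y - xs n))"
    by (rule perturbed_minimum_exists[of D h m z0 u, OF lsc bdd z0 first cont bd sA(1) dec lim supp R])
       (assumption | rule that)+
  have "C1_on UNIV (\<lambda>x. \<Sum>n. u n (x - xs n))"
    by (rule C1_on_suminf[OF der cont' bd' sA(2)])
       (rule summable_comparison_test'[OF sA(1)], use bd in auto)
  moreover have "(\<Sum>n. u n (x - xs n)) = 0" if x: "dist z0 x \<ge> r" for x
  proof -
    have "u n (x - xs n) = 0" for n
    proof (rule supp)
      have "R / 2 ^ n \<le> R" using R by (simp add: divide_le_eq)
      moreover have "dist z0 x \<le> dist z0 (xs n) + dist (xs n) x" by (rule dist_triangle)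
      ultimately show "R / 2 ^ n \<le> norm (x - xs n)"
        using x xs(1)[of n] R by (simp add: R_def dist_norm norm_minus_commute)
    qed
    then show ?thesis by simp
  qed
  moreover have "dist z0 z < r" using xs(3) r by (simp add: R_def)
  ultimately show thesis using xs(2,4)
    by (intro that[of "\<lambda>x. \<Sum>n. u n (x - xs n)" z])
qed

section \<open>Localisation on the manifold\<close>

text \<open>Cover the space by \<open>U\<close> and by open sets whose closures miss
  \<open>x\<close>. In a locally finite refinement, the members not inside \<open>U\<close> have
  closures missing \<open>x\<close>, and local finiteness lets closure commute with their union. The
  complement of that closure is the desired \<open>V\<close>.\<close>

lemma paracompact_t2_shrink:
  fixes x :: "'m::t2_space"
  assumes "paracompact_space (euclidean :: 'm topology)" "open U" "x \<in> U"
  obtains V where "open V" "x \<in> V" "closure V \<subseteq> U"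
proof -
  define \<U> where "\<U> = insert U {W. open W \<and> x \<notin> closure W}"
  have "\<exists>W. y \<in> W \<and> open W \<and> x \<notin> closure W" if y: "y \<notin> U" for y
  proof -
    have "x \<noteq> y" using y assms(3) by blast
    then obtain A B where "open A" "open B" "x \<in> A" "y \<in> B" "A \<inter> B = {}"
      by (metis hausdorff)
    then show ?thesis
      by (metis disjoint_iff open_Int_closure_eq_empty)
  qed
  then have "\<Union>\<U> = UNIV" unfolding \<U>_def by blast
  moreover have "\<forall>W\<in>\<U>. openin euclidean W" using assms(2) by (auto simp: \<U>_def)
  ultimately have "(\<forall>W\<in>\<U>. openin euclidean W) \<and> \<Union>\<U> = topspace euclidean" by simp
  with assms(1) have "\<exists>\<V>. (\<forall>W\<in>\<V>. openin euclidean W \<and> (\<exists>A\<in>\<U>. W \<subseteq> A)) \<and>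
      \<Union>\<V> = topspace euclidean \<and> locally_finite_in euclidean \<V>"
    unfolding paracompact_space_def by (elim allE impE)
  then obtain \<V> where \<V>: "\<forall>W\<in>\<V>. openin euclidean W \<and> (\<exists>A\<in>\<U>. W \<subseteq> A)"
      "\<Union>\<V> = UNIV" "locally_finite_in euclidean \<V>"
    unfolding topspace_euclidean by (elim exE conjE)
  define \<W> where "\<W> = {W \<in> \<V>. \<not> W \<subseteq> U}"
  have "locally_finite_in euclidean \<W>"
    using \<V>(3) by (rule locally_finite_in_subset) (auto simp: \<W>_def)
  then have cl: "closure (\<Union>\<W>) = \<Union>(closure ` \<W>)"
    using closure_of_locally_finite_Union[of euclidean \<W>] by simp
  have "x \<notin> closure W" if "W \<in> \<W>" for W
  proof -
    from that \<V>(1) obtain A where "A \<in> \<U>" "W \<subseteq> A" "\<not> W \<subseteq> U" unfolding \<W>_def by blast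
    then show ?thesis using closure_mono[of W A] by (auto simp: \<U>_def)
  qed
  then have "x \<in> - closure (\<Union>\<W>)" using cl by auto
  \<comment> \<open>The set \<open>- \<Union>\<W>\<close> is closed, and it lies in \<open>U\<close>
    because the refinement covers the space.\<close>
  moreover have "closure (- closure (\<Union>\<W>)) \<subseteq> U"
  proof -
    have "open (\<Union>\<W>)" using \<V>(1) by (auto simp: \<W>_def)
    then have "closure (- closure (\<Union>\<W>)) \<subseteq> - \<Union>\<W>"
      using closure_subset[of "\<Union>\<W>"] by (intro closure_minimal) (auto simp: closed_Compl)
    also have "\<dots> \<subseteq> U"
    proof
      fix y assume y: "y \<in> - \<Union>\<W>"
      have "y \<in> \<Union>\<V>" unfolding \<V>(2) by simp
      then obtain W where "W \<in> \<V>" "y \<in> W" ..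
      with y show "y \<in> U" by (auto simp: \<W>_def)
    qed
    finally show ?thesis .
  qed
  ultimately show thesis by (intro that[of "- closure (\<Union>\<W>)"]) auto
qed

section \<open>Charts and extension by zero\<close>

lemma chart_simps:
  assumes "is_chart c"
  shows "y \<in> fst c \<Longrightarrow> chart_inv c (snd c y) = y"
    and "v \<in> snd c ` fst c \<Longrightarrow> snd c (chart_inv c v) = v"
    and "v \<in> snd c ` fst c \<Longrightarrow> chart_inv c v \<in> fst c"
  using assms unfolding is_chart_def homeomorphism_def by auto

lemma open_chart_image:
  assumes "is_chart c" "open S" "S \<subseteq> fst c"
  shows "open (snd c ` S)"
proof -
  have "snd c ` S = (snd c ` fst c) \<inter> chart_inv c -` S"
  proof (intro set_eqI iffI)
    fix v assume "v \<in> snd c ` fst c \<inter> chart_inv c -` S"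
    then show "v \<in> snd c ` S"
      using chart_simps(2)[OF assms(1), of v] by (intro image_eqI[of _ _ "chart_inv c v"]) auto
  qed (use assms(3) chart_simps(1)[OF assms(1)] in auto)
  moreover have "open (\<dots>)"
    using assms unfolding is_chart_def homeomorphism_def
    by (intro continuous_open_preimage) auto
  ultimately show ?thesis by simp
qed

text \<open>In any chart \<open>d\<close>, the points over \<open>fst c\<close> see \<open>G\<close>
  composed with a transition map, and the points off \<open>K\<close> see zero. Closedness of
  \<open>K\<close> in the manifold makes the second region open, and
  \<open>K \<subseteq> fst c\<close> makes the two regions cover the chart.\<close>

lemma C1_fun_extend_by_zero:
  assumes A: "C1_structure \<A>" and c: "c \<in> \<A>" and G: "C1_on UNIV G"
    and K: "closed K" "K \<subseteq> fst c" and zero: "\<And>y. y \<in> fst c - K \<Longrightarrow> G (snd c y) = 0"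
  shows "C1_fun \<A> (\<lambda>y. if y \<in> fst c then G (snd c y) else 0)"
  unfolding C1_fun_def
proof
  let ?g = "\<lambda>y. if y \<in> fst c then G (snd c y) else 0"
  fix d assume d: "d \<in> \<A>"
  have chc: "is_chart c" and chd: "is_chart d" and comp: "C1_compatible d c"
    using A c d unfolding C1_structure_def by blast+
  have opc: "open (fst c)" and opd: "open (fst d)" using chc chd by (auto simp: is_chart_def)
  let ?S = "snd d ` (fst d \<inter> fst c)" and ?T = "snd d ` (fst d - K)"
  have S: "open ?S" by (intro open_chart_image[OF chd] open_Int opc opd) auto
  have T: "open ?T" by (intro open_chart_image[OF chd] open_Diff opd K(1)) auto
  have "C1_on ?S (transition d c)" using comp unfolding C1_compatible_def by blast
  from C1_on_compose[OF this G] have "C1_on ?S (G \<circ> transition d c)" by simp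
  then have "C1_on ?S (?g \<circ> chart_inv d)"
    by (rule C1_on_cong[OF _ S]) (auto simp: transition_def chart_simps[OF chd])
  moreover have "C1_on ?T (?g \<circ> chart_inv d)"
    by (rule C1_on_cong[OF C1_on_const[of _ 0] T]) (auto simp: chart_simps[OF chd] zero)
  ultimately have "C1_on (?S \<union> ?T) (?g \<circ> chart_inv d)"
    using S T by (intro C1_on_open_Un)
  then show "C1_on (snd d ` fst d) (?g \<circ> chart_inv d)"
    by (rule C1_on_subset) (use K(2) in blast)
qed

section \<open>Points of subdifferentiability near a given point\<close>

text \<open>The function is transported through a chart to a closed ball, minimised there after a
  smooth perturbation, and the perturbation is pulled back to the manifold as a test
  function.\<close>

lemma subdifferentiable_nearby:
  fixes \<A> :: "('m::t2_space, 'x::banach) chart set" and f :: "'m \<Rightarrow> ereal" and b :: "'x \<Rightarrow> real"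
  assumes M: "paracompact_space (euclidean :: 'm topology)" "C1_structure \<A>"
    and b: "C1_Lipschitz_bump b"
    and f: "\<And>x. f x \<noteq> -\<infinity>" "lower_semicontinuous f"
    and x0: "x0 \<in> edom f" "x0 \<in> W" "open W"
  obtains x where "x \<in> W" "x \<in> edom f" "subdifferential \<A> f x \<noteq> {}"
proof -
  obtain c where c: "c \<in> \<A>" "x0 \<in> fst c" using M(2) unfolding C1_structure_def by blast
  have ch: "is_chart c" using M(2) c unfolding C1_structure_def by blast
  have opc: "open (fst c)" using ch by (simp add: is_chart_def)
  obtain V where V: "open V" "x0 \<in> V" "closure V \<subseteq> fst c"
    by (rule paracompact_t2_shrink[OF M(1) opc c(2)]) (rule that)
  have fx0: "\<bar>f x0\<bar> \<noteq> \<infinity>" using x0(1) f(1)[of x0] by (auto simp: edom_def)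
  define m where "m = real_of_ereal (f x0) - 1"
  have "ereal m < f x0" using fx0 by (cases "f x0") (auto simp: m_def)
  then obtain E where E: "open E" "x0 \<in> E" "\<And>y. y \<in> E \<Longrightarrow> m < f y"
    using f(2)[unfolded lower_semicontinuous_def eventually_nhds, rule_format, of m x0] by blast
  \<comment> \<open>\<open>V\<close> keeps closures inside the chart domain, \<open>W\<close> is the
    target neighbourhood, and \<open>E\<close> supplies the lower bound \<open>m\<close>.\<close>
  define Oo where "Oo = V \<inter> W \<inter> E"
  have O: "open Oo" "x0 \<in> Oo" "Oo \<subseteq> fst c"
    using V E x0 closure_subset[of V] by (auto simp: Oo_def)
  define z0 where "z0 = snd c x0"
  have "open (snd c ` Oo)" using open_chart_image[OF ch O(1,3)] .
  then obtain r where r: "r > 0" "cball z0 r \<subseteq> snd c ` Oo"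
    using O(2) open_contains_cball unfolding z0_def by (metis imageI)
  have ci: "chart_inv c v \<in> Oo" "snd c (chart_inv c v) = v" if "v \<in> cball z0 r" for v
  proof -
    have "v \<in> snd c ` Oo" using r(2) that by (rule subsetD)
    then obtain y where y: "y \<in> Oo" "v = snd c y" by blast
    with O(3) have "chart_inv c v = y" using chart_simps(1)[OF ch] by auto
    then show "chart_inv c v \<in> Oo" "snd c (chart_inv c v) = v" using y by simp_all
  qed
  have cont_inv: "continuous_on (cball z0 r) (chart_inv c)"
  proof (rule continuous_on_subset)
    show "continuous_on (snd c ` fst c) (chart_inv c)"
      using ch unfolding is_chart_def homeomorphism_def by blast
    show "cball z0 r \<subseteq> snd c ` fst c" using r(2) O(3) by blast
  qed
  have cont_c: "continuous_on (fst c) (snd c)"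
    using ch unfolding is_chart_def homeomorphism_def by blast
  \<comment> \<open>On \<open>D\<close> the value of \<open>f\<close> is finite, so \<open>h\<close>
    represents it faithfully; elsewhere on the ball \<open>real_of_ereal\<close> returns the default
    0.\<close>
  define D where "D = {v \<in> cball z0 r. f (chart_inv c v) < \<infinity>}"
  define h where "h v = real_of_ereal (f (chart_inv c v))" for v
  have fh: "f (chart_inv c v) = ereal (h v)" if "v \<in> D" for v
    using that f(1)[of "chart_inv c v"] unfolding D_def h_def
    by (cases "f (chart_inv c v)") auto
  obtain G z where G: "C1_on UNIV G" "\<And>v. dist z0 v \<ge> r \<Longrightarrow> G v = (0::real)"
    and z: "z \<in> D" "dist z0 z < r" "\<And>y. y \<in> D \<Longrightarrow> h z - G z \<le> h y - G y"
  proof (rule smooth_perturbed_minimum[OF b, of D h m z0 r])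
    fix a :: real
    have "closed {y. f y \<le> ereal a}"
    proof -
      have "open {y. ereal a < f y}"
        by (subst open_subopen)
           (use f(2) in \<open>auto simp: lower_semicontinuous_def eventually_nhds subset_eq\<close>)
      moreover have "{y. f y \<le> ereal a} = - {y. ereal a < f y}" by auto
      ultimately show ?thesis by (simp add: closed_def)
    qed
    then have "closed (cball z0 r \<inter> chart_inv c -` {y. f y \<le> ereal a})"
      by (intro continuous_closed_preimage cont_inv) auto
    moreover have "cball z0 r \<inter> chart_inv c -` {y. f y \<le> ereal a} = {v \<in> D. h v \<le> a}"
    proof (intro set_eqI iffI)
      fix v assume v: "v \<in> cball z0 r \<inter> chart_inv c -` {y. f y \<le> ereal a}"
      then have "v \<in> D" by (auto simp: D_def intro: le_less_trans)
      then show "v \<in> {v \<in> D. h v \<le> a}" using v fh[of v] by auto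
    next
      fix v assume v: "v \<in> {v \<in> D. h v \<le> a}"
      then have "v \<in> D" by simp
      then show "v \<in> cball z0 r \<inter> chart_inv c -` {y. f y \<le> ereal a}"
        using v fh[of v] unfolding D_def by auto
    qed
    ultimately show "closed {v \<in> D. h v \<le> a}" by simp
  next
    fix v assume v: "v \<in> D"
    then have "m < f (chart_inv c v)" using E(3) ci(1) by (auto simp: D_def Oo_def)
    then show "m \<le> h v" using fh[OF v] by simp
  next
    show "z0 \<in> D" using x0(1) r(1) chart_simps(1)[OF ch c(2)] by (simp add: D_def z0_def edom_def)
  qed (assumption | rule r(1) that)+
  \<comment> \<open>The preimage of the ball is closed a priori only relative to the chart domain.
    Intersecting with \<open>closure V\<close>, which the domain contains, makes it closed in the
    manifold.\<close>
  define K where "K = closure V \<inter> snd c -` cball z0 r"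
  have "closed K" unfolding K_def
    by (intro continuous_closed_preimage continuous_on_subset[OF cont_c V(3)]) auto
  moreover have "K \<subseteq> fst c" using V(3) by (auto simp: K_def)
  \<comment> \<open>A point of the chart domain mapped into the ball lies in \<open>Oo\<close>,
    hence in \<open>V\<close>, hence in \<open>K\<close>.\<close>
  moreover have "G (snd c y) = 0" if y: "y \<in> fst c - K" for y
  proof (rule G(2), rule ccontr)
    assume "\<not> dist z0 (snd c y) \<ge> r"
    then have in_ball: "snd c y \<in> cball z0 r" by simp
    then have "y \<in> Oo" using ci(1)[OF in_ball] chart_simps(1)[OF ch, of y] y by simp
    then show False using y in_ball closure_subset[of V] by (auto simp: K_def Oo_def)
  qed
  ultimately have C1: "C1_fun \<A> (\<lambda>y. if y \<in> fst c then G (snd c y) else 0)" (is "C1_fun \<A> ?g")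
    by (rule C1_fun_extend_by_zero[OF M(2) c(1) G(1)])
  define x where "x = chart_inv c z"
  have zb: "z \<in> cball z0 r" using z(1) by (simp add: D_def)
  have xO: "x \<in> Oo" "snd c x = z" using ci[OF zb] by (auto simp: x_def)
  \<comment> \<open>The minimiser lies in the open ball, whose preimage is an open neighbourhood of
    \<open>x\<close>. Points there with \<open>f y = \<infinity>\<close> satisfy the inequality
    trivially, and all others correspond to points of \<open>D\<close>.\<close>
  have "local_minimum_at (\<lambda>y. f y - ereal (?g y)) x"
    unfolding local_minimum_at_def eventually_nhds
  proof (intro exI conjI ballI)
    show "open (fst c \<inter> snd c -` ball z0 r)"
      using cont_c opc by (intro continuous_open_preimage) auto
    show "x \<in> fst c \<inter> snd c -` ball z0 r" using xO O(3) z(2) by auto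
    fix y assume y: "y \<in> fst c \<inter> snd c -` ball z0 r"
    show "f x - ereal (?g x) \<le> f y - ereal (?g y)"
    proof (cases "f y = \<infinity>")
      case False
      have yy: "chart_inv c (snd c y) = y" using y chart_simps(1)[OF ch] by blast
      have yD: "snd c y \<in> D" using y False by (auto simp: D_def yy less_imp_le)
      then show ?thesis
        using z(3)[OF yD] fh[OF yD] fh[OF z(1)] y xO O(3) by (auto simp: yy x_def)
    qed simp
  qed
  then have "subdifferential \<A> f x \<noteq> {}" using C1 unfolding subdifferential_def by blast
  moreover have "x \<in> W" "x \<in> edom f"
    using xO(1) z(1) by (auto simp: Oo_def edom_def D_def x_def)
  ultimately show thesis using that by blast
qed

theorem proposition2p13:
  fixes \<A> :: "('m::t2_space, 'x::banach) chart set"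
    and N :: "'m \<times> ('m, 'x) tangent \<Rightarrow> real"
    and f :: "'m \<Rightarrow> ereal"
  assumes "C1_Finsler_manifold \<A> N"
    and "\<exists>b :: 'x \<Rightarrow> real. C1_Lipschitz_bump b"
    and "\<And>x. f x \<noteq> -\<infinity>"
    and "proper_fun f"
    and "lower_semicontinuous f"
  shows "edom f \<subseteq> closure {x \<in> edom f. subdifferential \<A> f x \<noteq> {}}"
proof
  fix x0 assume x0: "x0 \<in> edom f"
  obtain b :: "'x \<Rightarrow> real" where b: "C1_Lipschitz_bump b" using assms(2) ..
  have M: "paracompact_space (euclidean :: 'm topology)" "C1_structure \<A>"
    using assms(1) by (simp_all add: C1_Finsler_manifold_def)
  let ?S = "{x \<in> edom f. subdifferential \<A> f x \<noteq> {}}"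
  show "x0 \<in> closure ?S"
  proof (rule ccontr)
    assume "x0 \<notin> closure ?S"
    then have "x0 \<in> - closure ?S" by simp
    then show False
    \<comment> \<open>The neighbourhood \<open>W\<close> is the complement of the closure itself, so
      the point found contradicts its own membership in \<open>?S\<close>.\<close>
    proof (rule subdifferentiable_nearby[OF M b assms(3,5) x0])
      show "open (- closure ?S)" by (simp add: open_Compl)
      fix x assume "x \<in> - closure ?S" "x \<in> edom f" "subdifferential \<A> f x \<noteq> {}"
      then show False using closure_subset[of ?S] by auto
    qed
  qed
qed

end
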